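(* Let $\Gamma=(G,\sigma)$ be a signed graph with $m$ vertices and let $\Gamma'=\Gamma-e$ be the signed graph obtained from $\Gamma$ by removing an edge $e$ with $\sigma(e)=+$. If $(\alpha_1,\dots,\alpha_m)$ and $(\beta_1,\dots,\beta_m)$ are the ordered net-Laplacian spectra of $\Gamma$ and $\Gamma'$ respectively, then \[ \alpha_{p-1}\leqslant\beta_p\leqslant\alpha_p\quad\text{for } p=1,2,\dots,m, \] with the convention that $\alpha_0=-m$.
   Context: A signed graph $(G,\sigma)$ consists of a finite simple undirected graph $G$ and a map $\sigma:E(G)\to\{+1,-1\}$. The adjacency matrix $A(\Gamma)$ has $(l,k)$ entry $\sigma(u_lu_k)$ if $u_l,u_k$ are adjacent and $0$ otherwise. For a vertex $u$, $d_u^+$, $d_u^-$ are the numbers of positive and negative edges at $u$ and $\mathrm{sdeg}(u)=d_u^+-d_u^-$. The net-Laplacian is $N(\Gamma)=D^{\pm}(\Gamma)-A(\Gamma)$ with $D^{\pm}(\Gamma)=\mathrm{diag}(\mathrm{sdeg}(u_1),\dots,\mathrm{sdeg}(u_m))$. The ordered spectrum is the list of eigenvalues with multiplicity in non-decreasing order. Removing an edge keeps the signs of all other edges. *)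

theory Defs
  imports "Jordan_Normal_Form.Char_Poly"
begin

text \<open>
  Edges are two-element sets of vertices. Only the values of \<open>sign\<close> on edges matter,
  so deleting an edge leaves the \<open>sign\<close> field untouched.
\<close>

record 'a signed_graph =
  verts :: "'a set"
  edges :: "'a set set"
  sign :: "'a set \<Rightarrow> int"

definition signed_graph :: "'a signed_graph \<Rightarrow> bool" where
  "signed_graph \<Gamma> \<longleftrightarrow>
     finite (verts \<Gamma>) \<and>
     (\<forall>e\<in>edges \<Gamma>. e \<subseteq> verts \<Gamma> \<and> card e = 2) \<and>
     (\<forall>e\<in>edges \<Gamma>. sign \<Gamma> e \<in> {1, -1})"

definition remove_edge :: "'a signed_graph \<Rightarrow> 'a set \<Rightarrow> 'a signed_graph" where
  "remove_edge \<Gamma> e = \<Gamma>\<lparr>edges := edges \<Gamma> - {e}\<rparr>"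

definition pos_degree :: "'a signed_graph \<Rightarrow> 'a \<Rightarrow> nat" where
  "pos_degree \<Gamma> u = card {e \<in> edges \<Gamma>. u \<in> e \<and> sign \<Gamma> e = 1}"

definition neg_degree :: "'a signed_graph \<Rightarrow> 'a \<Rightarrow> nat" where
  "neg_degree \<Gamma> u = card {e \<in> edges \<Gamma>. u \<in> e \<and> sign \<Gamma> e = -1}"

definition sdeg :: "'a signed_graph \<Rightarrow> 'a \<Rightarrow> int" where
  "sdeg \<Gamma> u = int (pos_degree \<Gamma> u) - int (neg_degree \<Gamma> u)"

text \<open>
  The matrices are taken with respect to an enumeration \<open>us\<close> of the vertices,
  indexed from 0.
\<close>

definition adj_matrix :: "'a signed_graph \<Rightarrow> 'a list \<Rightarrow> real mat" where
  "adj_matrix \<Gamma> us = mat (length us) (length us) (\<lambda>(l, k).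
     if {us ! l, us ! k} \<in> edges \<Gamma> then of_int (sign \<Gamma> {us ! l, us ! k}) else 0)"

definition sdeg_matrix :: "'a signed_graph \<Rightarrow> 'a list \<Rightarrow> real mat" where
  "sdeg_matrix \<Gamma> us = mat (length us) (length us) (\<lambda>(l, k).
     if l = k then of_int (sdeg \<Gamma> (us ! l)) else 0)"

definition net_laplacian :: "'a signed_graph \<Rightarrow> 'a list \<Rightarrow> real mat" where
  "net_laplacian \<Gamma> us = sdeg_matrix \<Gamma> us - adj_matrix \<Gamma> us"

text \<open>
  The real eigenvalues with algebraic multiplicity, in non-decreasing order. For symmetric
  matrices, such as the net-Laplacian, these are all the eigenvalues; see
  \<open>length_ordered_spectrum_net_laplacian\<close> below.
\<close>

definition ordered_spectrum :: "real mat \<Rightarrow> real list" where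
  "ordered_spectrum M = sorted_list_of_multiset (proots (char_poly M))"

lemma eigenvalue_real_symmetric:
  fixes M :: "real mat" and a :: complex
  assumes M: "M \<in> carrier_mat n n"
    and sym: "\<And>i j. i < n \<Longrightarrow> j < n \<Longrightarrow> M $$ (i, j) = M $$ (j, i)"
    and ev: "eigenvalue (map_mat of_real M) a"
  shows "a \<in> \<real>"
proof -
  define C :: "complex mat" where "C = map_mat of_real M"
  have C: "C \<in> carrier_mat n n" using M by (simp add: C_def)
  obtain v where "eigenvector C v a" using ev by (auto simp: eigenvalue_def C_def)
  then have v: "v \<in> carrier_vec n" "v \<noteq> 0\<^sub>v n" "C *\<^sub>v v = a \<cdot>\<^sub>v v"
    using C by (auto simp: eigenvector_def)
  have comp: "(\<Sum>j<n. of_real (M $$ (i, j)) * v $ j) = a * v $ i" if "i < n" for i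
  proof -
    have "(C *\<^sub>v v) $ i = (\<Sum>j<n. of_real (M $$ (i, j)) * v $ j)"
      using that C M v(1) by (auto simp: scalar_prod_def C_def atLeast0LessThan intro!: sum.cong)
    then show ?thesis using v that by simp
  qed
  define q where "q = (\<Sum>i<n. \<Sum>j<n. cnj (v $ i) * of_real (M $$ (i, j)) * v $ j)"
  define s where "s = (\<Sum>i<n. cnj (v $ i) * v $ i)"
  have q: "q = a * s"
  proof -
    have "q = (\<Sum>i<n. cnj (v $ i) * (\<Sum>j<n. of_real (M $$ (i, j)) * v $ j))"
      by (simp add: q_def sum_distrib_left mult.assoc)
    also have "\<dots> = (\<Sum>i<n. cnj (v $ i) * (a * v $ i))"
      by (intro sum.cong) (simp_all add: comp)
    finally show ?thesis by (simp add: s_def sum_distrib_left algebra_simps)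
  qed
  have "cnj q = (\<Sum>i<n. \<Sum>j<n. v $ i * of_real (M $$ (i, j)) * cnj (v $ j))"
    by (simp add: q_def)
  also have "\<dots> = (\<Sum>j<n. \<Sum>i<n. v $ i * of_real (M $$ (i, j)) * cnj (v $ j))"
    by (rule sum.swap)
  also have "\<dots> = q"
    unfolding q_def by (intro sum.cong refl) (simp add: sym mult.commute mult.left_commute)
  finally have cq: "cnj q = q" .
  have sr: "s = of_real (\<Sum>i<n. (cmod (v $ i))\<^sup>2)"
    by (simp only: s_def of_real_sum)
       (intro sum.cong refl, metis complex_norm_square mult.commute)
  have "s \<noteq> 0"
  proof
    assume "s = 0"
    then have "(\<Sum>i<n. (cmod (v $ i))\<^sup>2) = 0" using sr by (metis of_real_eq_0_iff)
    then have "\<forall>i<n. v $ i = 0" by (subst (asm) sum_nonneg_eq_0_iff) auto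
    then have "v = 0\<^sub>v n" using v(1) by (intro eq_vecI) auto
    then show False using v by simp
  qed
  moreover have "cnj a * s = a * s" using cq q sr by (metis complex_cnj_mult complex_cnj_complex_of_real)
  ultimately have "cnj a = a" by simp
  then show ?thesis by (simp add: Reals_cnj_iff)
qed

lemma length_ordered_spectrum_symmetric:
  fixes M :: "real mat"
  assumes M: "M \<in> carrier_mat n n"
    and sym: "\<And>i j. i < n \<Longrightarrow> j < n \<Longrightarrow> M $$ (i, j) = M $$ (j, i)"
  shows "length (ordered_spectrum M) = n"
proof -
  define C :: "complex mat" where "C = map_mat of_real M"
  have C: "C \<in> carrier_mat n n" using M by (simp add: C_def)
  obtain as where as: "char_poly C = (\<Prod>a\<leftarrow>as. [:- a, 1:])" "length as = n"
    using char_poly_factorized[OF C] by blast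
  have "a \<in> \<real>" if "a \<in> set as" for a
  proof -
    have "poly (char_poly C) a = 0"
      using that by (auto simp: as poly_prod_list prod_list_zero_iff)
    then have "eigenvalue C a" using eigenvalue_root_char_poly[OF C] by simp
    then show ?thesis using eigenvalue_real_symmetric[OF M sym] by (simp add: C_def)
  qed
  then have "map (of_real \<circ> Re) as = as" by (simp add: map_idI)
  then obtain bs where bs: "as = map of_real (bs :: real list)"
    by (metis map_map)
  interpret h: map_poly_inj_idom_hom "of_real :: real \<Rightarrow> complex" ..
  have "map_poly (of_real :: real \<Rightarrow> complex) (char_poly M) = char_poly C"
    unfolding C_def by (rule of_real_hom.char_poly_hom[OF M, symmetric])
  also have "\<dots> = map_poly of_real (\<Prod>b\<leftarrow>bs. [:- b, 1:])"
    by (simp add: as bs h.hom_prod_list o_def)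
  finally have "char_poly M = (\<Prod>b\<leftarrow>bs. [:- b, 1:])" by simp
  moreover have "proots (\<Prod>b\<leftarrow>bs. [:- b, 1:]) = mset bs" for bs :: "real list"
  proof (induction bs)
    case (Cons b bs)
    have "(\<Prod>b\<leftarrow>bs. [:- b, 1:]) \<noteq> 0" by (auto simp: prod_list_zero_iff)
    then have "proots ([:- b, 1:] * (\<Prod>b\<leftarrow>bs. [:- b, 1:])) =
        proots [:- b, 1:] + proots (\<Prod>b\<leftarrow>bs. [:- b, 1:])"
      by (intro proots_mult) (simp del: mult_pCons_left)
    then show ?case using Cons by (simp del: mult_pCons_left)
  qed simp
  ultimately have "mset (ordered_spectrum M) = mset bs"
    by (simp add: ordered_spectrum_def)
  then have "length (ordered_spectrum M) = length bs" by (rule mset_eq_length)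
  then show ?thesis using as bs by simp
qed

lemma length_ordered_spectrum_net_laplacian:
  "length (ordered_spectrum (net_laplacian \<Gamma> us)) = length us"
  by (rule length_ordered_spectrum_symmetric)
     (auto simp: net_laplacian_def sdeg_matrix_def adj_matrix_def insert_commute)

end

theory Submission
  imports Defs
begin

text \<open>
  Removing the positive edge \<open>{u\<^sub>i, u\<^sub>j}\<close> subtracts the rank-one form \<open>(x\<^sub>i - x\<^sub>j)\<^sup>2\<close> from the
  quadratic form of the net-Laplacian. Both inequalities between the spectra then follow as in
  the Courant-Fischer argument: \<open>m - 1\<close> linear conditions leave a nonzero vector orthogonal to
  the low eigenvectors of one matrix and the high eigenvectors of the other, and, for
  \<open>\<alpha>\<^bsub>p-1\<^esub> \<le> \<beta>\<^sub>p\<close>, killed by the rank-one form. The bound by \<open>-m\<close> holds because the signs are at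
  least \<open>-1\<close> and the Laplacian of the complete graph has largest eigenvalue at most \<open>m\<close>.
\<close>

section \<open>Nonzero solutions of homogeneous linear conditions\<close>

text \<open>There is one condition fewer than the dimension, so the conditions together with a zero
  row form a square matrix of determinant 0, whose kernel contains the required vector.\<close>

lemma ex_nonzero_vec_orthogonal:
  fixes q :: "nat \<Rightarrow> 'a :: idom vec"
  assumes "\<And>i. i < n \<Longrightarrow> q i \<in> carrier_vec (Suc n)"
  obtains x where "x \<in> carrier_vec (Suc n)" "x \<noteq> 0\<^sub>v (Suc n)" "\<And>i. i < n \<Longrightarrow> q i \<bullet> x = 0"
proof -
  define M where "M = mat\<^sub>r (Suc n) (Suc n) (\<lambda>i. if i = n then 0\<^sub>v (Suc n) else q i)"
  have M: "M \<in> carrier_mat (Suc n) (Suc n)" by (simp add: M_def)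
  have "M = mat\<^sub>r (Suc n) (Suc n)
      (\<lambda>i. if i = n then 0\<^sub>v (Suc n) else (if i < n then q i else 0\<^sub>v (Suc n)))"
    unfolding M_def by (intro eq_matI) auto
  also have "det \<dots> = 0" by (rule det_row_0) (use assms in auto)
  finally obtain x where x: "x \<in> carrier_vec (Suc n)" "x \<noteq> 0\<^sub>v (Suc n)"
      and Mx: "M *\<^sub>v x = 0\<^sub>v (Suc n)"
    using det_0_iff_vec_prod_zero[OF M] by blast
  have "q i \<bullet> x = 0" if "i < n" for i
  proof -
    have "(M *\<^sub>v x) $ i = 0" using Mx that by simp
    moreover have "row M i = q i" unfolding M_def using that assms[OF that] by (intro eq_vecI) auto
    ultimately show ?thesis using that M by simp
  qed
  then show thesis using x that by blast
qed

lemma real_vec_scalar_prod_pos: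
  fixes x :: "real vec"
  assumes "x \<in> carrier_vec n" "x \<noteq> 0\<^sub>v n"
  shows "0 < x \<bullet> x"
proof -
  obtain i where i: "i < n" "x $ i \<noteq> 0" using assms by (auto simp: vec_eq_iff)
  have "0 < (\<Sum>i = 0..<n. x $ i * x $ i)"
    by (rule sum_pos2[of _ i]) (use i in \<open>auto simp: zero_less_mult_iff linorder_neq_iff\<close>)
  then show ?thesis using assms by (simp add: scalar_prod_def)
qed

section \<open>Orthogonal diagonalisation of real symmetric matrices\<close>

text \<open>The reflection in the hyperplane orthogonal to \<open>u = v - unit_vec n 0\<close>
  exchanges the two unit vectors. It is symmetric and its own inverse, so conjugation by it keeps a
  matrix symmetric.\<close>

lemma householder_reflection:
  fixes v :: "real vec"
  assumes v: "v \<in> carrier_vec n" "v \<bullet> v = 1" and n: "0 < n"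
  obtains W where "W \<in> carrier_mat n n" "W\<^sup>T = W" "W * W = 1\<^sub>m n" "W *\<^sub>v unit_vec n 0 = v"
proof -
  define u where "u i = v $ i - (if i = 0 then 1 else 0)" for i
  define s where "s = (\<Sum>i<n. u i * u i)"
  \<comment> \<open>If \<open>v\<close> is already the first unit vector, then \<open>s = 0\<close>, so \<open>c = 0\<close> and \<open>W\<close> is the identity.\<close>
  define c where "c = 2 / s"
  define W where "W = mat n n (\<lambda>(i, j). (if i = j then 1 else 0) - c * u i * u j)"
  have W: "W \<in> carrier_mat n n" by (simp add: W_def)
  have u0: "u i = 0" if "s = 0" "i < n" for i
    using that unfolding s_def by (subst (asm) sum_nonneg_eq_0_iff) auto
  have "(\<Sum>i<n. v $ i * v $ i) = 1"
    using v by (simp add: scalar_prod_def atLeast0LessThan)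
  moreover have "s = (\<Sum>i<n. v $ i * v $ i - 2 * (if i = 0 then v $ i else 0) + (if i = 0 then 1 else 0))"
    unfolding s_def u_def by (intro sum.cong refl) (auto simp: algebra_simps)
  \<comment> \<open>Both vectors have length 1, so their squared distance is
    \<open>2 - 2 * v $ 0\<close>.\<close>
  ultimately have s: "s = - 2 * u 0"
    using n by (simp add: sum.distrib sum_subtractf sum_distrib_left[symmetric] u_def)
  \<comment> \<open>The first identity makes \<open>W\<close> an involution; the second says that
    \<open>W\<close> moves the first unit vector by \<open>u\<close>, that is, to
    \<open>v\<close>.\<close>
  have cs: "c * c * s * u i = 2 * c * u i" if "i < n" for i
    using u0[of i] that by (cases "s = 0") (auto simp: c_def)
  have cu: "c * u 0 * u i = - u i" if "i < n" for i
    using u0[of i] s that by (cases "s = 0") (auto simp: c_def)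
  have "W * W = 1\<^sub>m n"
  proof (rule eq_matI)
    fix i j assume "i < dim_row (1\<^sub>m n)" "j < dim_col (1\<^sub>m n)"
    then have ij: "i < n" "j < n" by auto
    have "(W * W) $$ (i, j) = (\<Sum>k<n. ((if i = k then 1 else 0) - c * u i * u k) *
        ((if k = j then 1 else 0) - c * u k * u j))"
      using ij by (simp add: W_def scalar_prod_def atLeast0LessThan)
    also have "\<dots> = (\<Sum>k<n. (if k = i then (if i = j then 1 else 0) else 0)
        - (if k = i then c * u i * u j else 0) - (if k = j then c * u i * u j else 0)
        + (c * c * u i * u j) * (u k * u k))"
      by (intro sum.cong refl) (auto simp: algebra_simps)
    also have "\<dots> = (if i = j then 1 else 0) - 2 * (c * u i * u j) + (c * c * s * u i) * u j"
      using ij by (simp add: sum.distrib sum_subtractf sum_distrib_left[symmetric] s_def)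
    also have "\<dots> = 1\<^sub>m n $$ (i, j)" using ij by (simp add: cs)
    finally show "(W * W) $$ (i, j) = 1\<^sub>m n $$ (i, j)" .
  qed (use W in auto)
  moreover have "W\<^sup>T = W" unfolding W_def by (intro eq_matI) auto
  moreover have "W *\<^sub>v unit_vec n 0 = v"
  proof (rule eq_vecI)
    fix i assume "i < dim_vec v"
    then have i: "i < n" using v by simp
    have "(W *\<^sub>v unit_vec n 0) $ i = W $$ (i, 0)"
      using i n W by (simp add: scalar_prod_right_unit)
    also have "\<dots> = (if i = 0 then 1 else 0) - c * u 0 * u i"
      using i n by (simp add: W_def)
    finally show "(W *\<^sub>v unit_vec n 0) $ i = v $ i" using cu[OF i] by (simp add: u_def)
  qed (use v W in auto)
  ultimately show thesis using W that by blast
qed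

text \<open>
  The vectors \<open>q i\<close> form an orthonormal eigenbasis. The proof splits off one eigenvalue by
  conjugating with a reflection that takes the first unit vector to an eigenvector.
\<close>

lemma symmetric_matrix_quadratic_form:
  fixes A :: "real mat"
  assumes "A \<in> carrier_mat n n" and "A\<^sup>T = A" and "mset es = proots (char_poly A)"
  shows "\<exists>q. (\<forall>i<n. q i \<in> carrier_vec n) \<and> (\<forall>x\<in>carrier_vec n.
    x \<bullet> x = (\<Sum>i<n. (q i \<bullet> x)\<^sup>2) \<and> x \<bullet> (A *\<^sub>v x) = (\<Sum>i<n. es ! i * (q i \<bullet> x)\<^sup>2))"
  using assms
proof (induction n arbitrary: A es)
  case 0
  then show ?case by (auto simp: scalar_prod_def)
next
  case (Suc n A es')
  note A = Suc.prems(1) and sym = Suc.prems(2)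
  have symA: "A $$ (i, j) = A $$ (j, i)" if "i < Suc n" "j < Suc n" for i j
    using arg_cong[OF sym, of "\<lambda>M. M $$ (i, j)"] A that by simp
  \<comment> \<open>The characteristic polynomial of a real symmetric matrix splits over the reals,
    so \<open>es'\<close> has full length and its head \<open>e\<close> exists.\<close>
  have "length es' = length (ordered_spectrum A)"
    unfolding ordered_spectrum_def by (metis Suc.prems(3) mset_sorted_list_of_multiset size_mset)
  then have "length es' = Suc n"
    using length_ordered_spectrum_symmetric[OF A symA] by simp
  then obtain e es where es': "es' = e # es" by (cases es') auto
  have cp0: "char_poly M \<noteq> 0" if "M \<in> carrier_mat k k" for M :: "real mat" and k
    using degree_monic_char_poly[OF that] by auto
  have "e \<in># proots (char_poly A)" using Suc.prems(3) es' by (metis list.set_intros(1) set_mset_mset)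
  then have "eigenvalue A e"
    using cp0[OF A] eigenvalue_root_char_poly[OF A] by simp
  then obtain v0 where v0: "v0 \<in> carrier_vec (Suc n)" "v0 \<noteq> 0\<^sub>v (Suc n)" "A *\<^sub>v v0 = e \<cdot>\<^sub>v v0"
    using A by (auto simp: eigenvalue_def eigenvector_def)
  define v where "v = (1 / sqrt (v0 \<bullet> v0)) \<cdot>\<^sub>v v0"
  have v: "v \<in> carrier_vec (Suc n)" using v0 by (simp add: v_def)
  have "v \<bullet> v = 1"
    using v0 real_vec_scalar_prod_pos[OF v0(1,2)] by (simp add: v_def)
  moreover have Av: "A *\<^sub>v v = e \<cdot>\<^sub>v v"
    using v0 A by (simp add: v_def mult_mat_vec smult_smult_assoc mult.commute)
  ultimately obtain W where W: "W \<in> carrier_mat (Suc n) (Suc n)" "W\<^sup>T = W" "W * W = 1\<^sub>m (Suc n)"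
      and We: "W *\<^sub>v unit_vec (Suc n) 0 = v"
    using householder_reflection[OF v] by auto
  have WW: "W *\<^sub>v (W *\<^sub>v x) = x" if "x \<in> carrier_vec (Suc n)" for x
    using that W by (metis assoc_mult_mat_vec one_mult_mat_vec)
  have Wsp: "(W *\<^sub>v y) \<bullet> x = y \<bullet> (W *\<^sub>v x)"
    if "x \<in> carrier_vec (Suc n)" "y \<in> carrier_vec (Suc n)" for x y
    using transpose_vec_mult_scalar[OF W(1) that] W(2) by simp
  define B where "B = W * A * W"
  have B: "B \<in> carrier_mat (Suc n) (Suc n)" using W A by (simp add: B_def)
  have Bx: "B *\<^sub>v x = W *\<^sub>v (A *\<^sub>v (W *\<^sub>v x))" if "x \<in> carrier_vec (Suc n)" for x
    using that A W
    by (simp add: B_def assoc_mult_mat_vec[of _ "Suc n" "Suc n" _ "Suc n"] del: assoc_mult_mat)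
  have "B\<^sup>T = W\<^sup>T * (A\<^sup>T * W\<^sup>T)"
    using A W(1) unfolding B_def by (metis transpose_mult mult_carrier_mat)
  then have BT: "B\<^sup>T = B" using W(1) A by (simp add: W(2) sym B_def)
  have symB: "B $$ (i, j) = B $$ (j, i)" if "i < Suc n" "j < Suc n" for i j
    using arg_cong[OF BT, of "\<lambda>M. M $$ (i, j)"] B that by simp
  have "B *\<^sub>v unit_vec (Suc n) 0 = e \<cdot>\<^sub>v (W *\<^sub>v v)"
    using Av W v by (simp add: Bx We mult_mat_vec)
  also have "W *\<^sub>v v = unit_vec (Suc n) 0"
    using WW[of "unit_vec (Suc n) 0"] We by simp
  finally have Bu: "B *\<^sub>v unit_vec (Suc n) 0 = e \<cdot>\<^sub>v unit_vec (Suc n) 0" .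
  have col0: "B $$ (i, 0) = (if i = 0 then e else 0)" if "i < Suc n" for i
    using arg_cong[OF Bu, of "\<lambda>u. u $ i"] that B by (simp add: scalar_prod_right_unit)
  define A' where "A' = mat n n (\<lambda>(i, j). B $$ (Suc i, Suc j))"
  define E where "E = mat 1 1 (\<lambda>_. e)"
  have A': "A' \<in> carrier_mat n n" and E: "E \<in> carrier_mat 1 1" by (simp_all add: A'_def E_def)
  \<comment> \<open>The first column of \<open>B\<close> is \<open>e\<close> times the first unit
    vector; by symmetry the first row has the same form.\<close>
  have Bblock: "B = four_block_mat E (0\<^sub>m 1 n) (0\<^sub>m n 1) A'"
  proof (rule eq_matI)
    fix i j
    assume "i < dim_row (four_block_mat E (0\<^sub>m 1 n) (0\<^sub>m n 1) A')"
      and "j < dim_col (four_block_mat E (0\<^sub>m 1 n) (0\<^sub>m n 1) A')"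
    then have ij: "i < Suc n" "j < Suc n" using A' E by auto
    then show "B $$ (i, j) = four_block_mat E (0\<^sub>m 1 n) (0\<^sub>m n 1) A' $$ (i, j)"
      using col0[of i] col0[of j] symB[of i j] A' E by (cases i; cases j) (auto simp: A'_def E_def)
  qed (use B A' E in auto)
  \<comment> \<open>Since \<open>W\<close> is its own inverse, \<open>A\<close> and \<open>B\<close>
    are similar. Hence the spectrum of \<open>A\<close> is \<open>e\<close> together with that of
    \<open>A'\<close>, and the induction hypothesis applies to \<open>A'\<close> with the tail
    \<open>es\<close>.\<close>
  have "A = W * B * W"
  proof -
    have "W * B * W = (W * W) * A * (W * W)"
      using W(1) A by (simp add: B_def assoc_mult_mat[of _ "Suc n" "Suc n" _ "Suc n" _ "Suc n"] del: W(3))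
    then show ?thesis using A by (simp add: W(3))
  qed
  then have "similar_mat A B"
    using A B W by (intro similar_matI[of _ _ W W "Suc n"]) auto
  then have "char_poly A = char_poly E * char_poly A'"
    using char_poly_similar char_poly_four_block_zeros_col[OF E _ A'] Bblock by (metis zero_carrier_mat)
  moreover have "char_poly E = [:- e, 1:]"
    by (simp add: char_poly_defs E_def det_single)
  ultimately have "proots (char_poly A) = {#e#} + proots (char_poly A')"
    using cp0[OF A'] by (simp add: proots_mult del: mult_pCons_left)
  then have "mset es = proots (char_poly A')" using Suc.prems(3) es' by simp
  moreover have "A'\<^sup>T = A'" using symB by (intro eq_matI) (auto simp: A'_def)
  ultimately obtain q where q: "\<And>i. i < n \<Longrightarrow> q i \<in> carrier_vec n"
    and qx: "\<And>x. x \<in> carrier_vec n \<Longrightarrow> x \<bullet> x = (\<Sum>i<n. (q i \<bullet> x)\<^sup>2)"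
      "\<And>x. x \<in> carrier_vec n \<Longrightarrow> x \<bullet> (A' *\<^sub>v x) = (\<Sum>i<n. es ! i * (q i \<bullet> x)\<^sup>2)"
    using Suc.IH[OF A'] by blast
  \<comment> \<open>An eigenbasis of \<open>B\<close>: the first unit vector, and the eigenbasis of
    \<open>A'\<close> with a leading 0. Applying \<open>W\<close> turns it into one of
    \<open>A\<close>. As \<open>W\<close> is symmetric, the coefficient of \<open>x\<close> along
    \<open>W *\<^sub>v w i\<close> is that of \<open>W *\<^sub>v x\<close> along
    \<open>w i\<close>.\<close>
  define w where "w i = (case i of 0 \<Rightarrow> unit_vec (Suc n) 0 | Suc j \<Rightarrow> 0\<^sub>v 1 @\<^sub>v q j)" for i
  have w: "w i \<in> carrier_vec (Suc n)" if "i < Suc n" for i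
    using that q append_carrier_vec[of "0\<^sub>v 1" 1 _ n] by (auto simp: w_def split: nat.split)
  show ?case
  proof (intro exI[of _ "\<lambda>i. W *\<^sub>v w i"] conjI allI impI ballI)
    show "W *\<^sub>v w i \<in> carrier_vec (Suc n)" if "i < Suc n" for i using w[OF that] W by simp
    fix x :: "real vec" assume x: "x \<in> carrier_vec (Suc n)"
    define y where "y = W *\<^sub>v x"
    have y: "y \<in> carrier_vec (Suc n)" using x W by (simp add: y_def)
    define a where "a = vec_first y 1"
    define d where "d = vec_last y n"
    have a: "a \<in> carrier_vec 1" and d: "d \<in> carrier_vec n" by (simp_all add: a_def d_def)
    have y_split: "y = a @\<^sub>v d" using vec_first_last_append[of y 1 n] y by (simp add: a_def d_def)
    have a0: "a $ 0 = y $ 0" by (simp add: a_def vec_first_def)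
    have c0: "(W *\<^sub>v w 0) \<bullet> x = y $ 0"
      using x y by (simp add: Wsp w_def y_def[symmetric] scalar_prod_left_unit)
    have cS: "(W *\<^sub>v w (Suc i)) \<bullet> x = q i \<bullet> d" if "i < n" for i
    proof -
      have "(W *\<^sub>v w (Suc i)) \<bullet> x = w (Suc i) \<bullet> y" using Wsp[OF x w] that by (simp add: y_def)
      also have "\<dots> = 0\<^sub>v 1 \<bullet> a + q i \<bullet> d"
        unfolding w_def y_split using scalar_prod_append[OF _ q a d] that by simp
      finally show ?thesis using a by simp
    qed
    have "x \<bullet> x = y \<bullet> y" using Wsp[OF y x] x by (simp add: y_def WW)
    also have "\<dots> = a \<bullet> a + d \<bullet> d" unfolding y_split by (rule scalar_prod_append[OF a d a d])
    also have "a \<bullet> a = (y $ 0)\<^sup>2" using a a0 by (simp add: scalar_prod_def power2_eq_square)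
    finally show "x \<bullet> x = (\<Sum>i<Suc n. ((W *\<^sub>v w i) \<bullet> x)\<^sup>2)"
      using d qx(1) by (simp add: sum.lessThan_Suc_shift c0 cS del: sum.lessThan_Suc)
    have "x \<bullet> (A *\<^sub>v x) = x \<bullet> (W *\<^sub>v (B *\<^sub>v y))"
      using x y A W by (simp add: Bx y_def WW)
    also have "\<dots> = y \<bullet> (B *\<^sub>v y)" using Wsp[of "B *\<^sub>v y" x] x y B by (simp add: y_def)
    also have "B *\<^sub>v y = (E *\<^sub>v a) @\<^sub>v (A' *\<^sub>v d)"
      unfolding Bblock y_split by (rule mult_mat_vec_split[OF E A' a d])
    also have "y \<bullet> \<dots> = a \<bullet> (E *\<^sub>v a) + d \<bullet> (A' *\<^sub>v d)"
      unfolding y_split using a d E A' by (intro scalar_prod_append) auto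
    also have "a \<bullet> (E *\<^sub>v a) = e * (y $ 0)\<^sup>2"
      using a a0 by (simp add: scalar_prod_def E_def power2_eq_square)
    finally show "x \<bullet> (A *\<^sub>v x) = (\<Sum>i<Suc n. es' ! i * ((W *\<^sub>v w i) \<bullet> x)\<^sup>2)"
      using d qx(2) by (simp add: sum.lessThan_Suc_shift c0 cS es' del: sum.lessThan_Suc)
  qed
qed


section \<open>Comparison of ordered spectra by quadratic forms\<close>

lemma sorted_ordered_spectrum: "sorted (ordered_spectrum A)"
  by (simp add: ordered_spectrum_def)

lemma ordered_spectrum_quadratic_form:
  assumes A: "A \<in> carrier_mat n n" and sym: "A\<^sup>T = A"
  obtains q where "\<And>i. i < n \<Longrightarrow> q i \<in> carrier_vec n"
    and "length (ordered_spectrum A) = n"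
    and "\<And>x. x \<in> carrier_vec n \<Longrightarrow> x \<bullet> x = (\<Sum>i<n. (q i \<bullet> x)\<^sup>2)"
    and "\<And>x. x \<in> carrier_vec n \<Longrightarrow>
      x \<bullet> (A *\<^sub>v x) = (\<Sum>i<n. ordered_spectrum A ! i * (q i \<bullet> x)\<^sup>2)"
proof -
  have "A $$ (i, j) = A $$ (j, i)" if "i < n" "j < n" for i j
    using arg_cong[OF sym, of "\<lambda>M. M $$ (i, j)"] A that by simp
  then have "length (ordered_spectrum A) = n" by (rule length_ordered_spectrum_symmetric[OF A])
  moreover have "mset (ordered_spectrum A) = proots (char_poly A)" by (simp add: ordered_spectrum_def)
  ultimately show thesis using symmetric_matrix_quadratic_form[OF A sym] that by blast
qed

text \<open>The upper half of the Courant-Fischer principle. Besides the \<open>c\<close> given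
  conditions, \<open>x\<close> is made orthogonal to the \<open>n - 1 - c\<close> eigenvectors of
  index above \<open>c\<close>. These are \<open>n - 1\<close> conditions in all, and only
  eigenvalues up to index \<open>c\<close> contribute to the form at \<open>x\<close>.\<close>

lemma ex_quadratic_form_le_ordered_spectrum:
  assumes A: "A \<in> carrier_mat n n" "A\<^sup>T = A" and c: "c < n"
    and r: "\<And>i. i < c \<Longrightarrow> r i \<in> carrier_vec n"
  obtains x where "x \<in> carrier_vec n" "x \<noteq> 0\<^sub>v n" "\<And>i. i < c \<Longrightarrow> r i \<bullet> x = 0"
    "x \<bullet> (A *\<^sub>v x) \<le> ordered_spectrum A ! c * (x \<bullet> x)"
proof -
  let ?a = "ordered_spectrum A"
  obtain q where q: "\<And>i. i < n \<Longrightarrow> q i \<in> carrier_vec n" and len: "length ?a = n"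
    and qx: "\<And>x. x \<in> carrier_vec n \<Longrightarrow> x \<bullet> x = (\<Sum>i<n. (q i \<bullet> x)\<^sup>2)"
      "\<And>x. x \<in> carrier_vec n \<Longrightarrow> x \<bullet> (A *\<^sub>v x) = (\<Sum>i<n. ?a ! i * (q i \<bullet> x)\<^sup>2)"
    using ordered_spectrum_quadratic_form[OF A] by blast
  obtain N where N: "n = Suc N" using c by (cases n) auto
  \<comment> \<open>The shift to \<open>Suc i\<close> leaves out \<open>q c\<close>, so the
    eigenvectors used are those of index \<open>c + 1\<close> to \<open>n - 1\<close>.\<close>
  define p where "p i = (if i < c then r i else q (Suc i))" for i
  have "p i \<in> carrier_vec (Suc N)" if "i < N" for i using that q r by (auto simp: p_def N)
  then obtain x where x: "x \<in> carrier_vec n" "x \<noteq> 0\<^sub>v n" and px: "\<And>i. i < N \<Longrightarrow> p i \<bullet> x = 0"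
    using ex_nonzero_vec_orthogonal[of N p] unfolding N by blast
  have "r i \<bullet> x = 0" if "i < c" for i using px[of i] that c by (simp add: p_def N)
  moreover have "x \<bullet> (A *\<^sub>v x) \<le> ?a ! c * (x \<bullet> x)"
    unfolding qx[OF x(1)] sum_distrib_left
  proof (intro sum_mono)
    fix i assume "i \<in> {..<n}"
    then have i: "i < n" by simp
    show "?a ! i * (q i \<bullet> x)\<^sup>2 \<le> ?a ! c * (q i \<bullet> x)\<^sup>2"
    proof (cases "i \<le> c")
      case True
      then show ?thesis using sorted_nth_mono[OF sorted_ordered_spectrum, of i c A] c len
        by (intro mult_right_mono) auto
    next
      case False
      then obtain i' where "i = Suc i'" "c \<le> i'" by (cases i) auto
      then show ?thesis using px[of i'] i by (simp add: p_def N)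
    qed
  qed
  ultimately show thesis using that x by blast
qed

text \<open>Without linear conditions, the preceding lemma gives a nonzero \<open>x\<close> at which
  the form is at most the smallest eigenvalue times \<open>x \<bullet> x\<close>; the assumed bound
  is evaluated at this \<open>x\<close>.\<close>

lemma ordered_spectrum_ge:
  assumes A: "A \<in> carrier_mat n n" "A\<^sup>T = A" and n: "0 < n"
    and le: "\<And>x. x \<in> carrier_vec n \<Longrightarrow> c * (x \<bullet> x) \<le> x \<bullet> (A *\<^sub>v x)"
  shows "c \<le> ordered_spectrum A ! 0"
proof -
  obtain x where x: "x \<in> carrier_vec n" "x \<noteq> 0\<^sub>v n"
    "x \<bullet> (A *\<^sub>v x) \<le> ordered_spectrum A ! 0 * (x \<bullet> x)"
    using ex_quadratic_form_le_ordered_spectrum[OF A n] by (metis not_less_zero)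
  then have "c * (x \<bullet> x) \<le> ordered_spectrum A ! 0 * (x \<bullet> x)" using le[OF x(1)] by linarith
  then show ?thesis using real_vec_scalar_prod_pos[OF x(1,2)] by simp
qed

text \<open>A nonzero \<open>x\<close> is chosen orthogonal to the first \<open>k\<close>
  eigenvectors of \<open>A\<close> and to all \<open>r i\<close>. The former bounds the form of
  \<open>A\<close> below by its eigenvalue of index \<open>k\<close>; these \<open>k + c\<close>
  conditions still allow the form of \<open>B\<close> to be bounded above by its eigenvalue of index
  \<open>k + c\<close>. Monotonicity is the case \<open>c = 0\<close>, and a rank-one change is the
  case \<open>c = 1\<close>.\<close>

lemma ordered_spectrum_le_shift:
  assumes A: "A \<in> carrier_mat n n" "A\<^sup>T = A" and B: "B \<in> carrier_mat n n" "B\<^sup>T = B"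
    and r: "\<And>i. i < c \<Longrightarrow> r i \<in> carrier_vec n" and k: "k + c < n"
    and le: "\<And>x. x \<in> carrier_vec n \<Longrightarrow> (\<And>i. i < c \<Longrightarrow> r i \<bullet> x = 0) \<Longrightarrow>
      x \<bullet> (A *\<^sub>v x) \<le> x \<bullet> (B *\<^sub>v x)"
  shows "ordered_spectrum A ! k \<le> ordered_spectrum B ! (k + c)"
proof -
  let ?a = "ordered_spectrum A"
  obtain q where q: "\<And>i. i < n \<Longrightarrow> q i \<in> carrier_vec n" and len: "length ?a = n"
    and qx: "\<And>x. x \<in> carrier_vec n \<Longrightarrow> x \<bullet> x = (\<Sum>i<n. (q i \<bullet> x)\<^sup>2)"
      "\<And>x. x \<in> carrier_vec n \<Longrightarrow> x \<bullet> (A *\<^sub>v x) = (\<Sum>i<n. ?a ! i * (q i \<bullet> x)\<^sup>2)"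
    using ordered_spectrum_quadratic_form[OF A] by blast
  define p where "p i = (if i < k then q i else r (i - k))" for i
  have "p i \<in> carrier_vec n" if "i < k + c" for i using that q r k by (auto simp: p_def)
  then obtain x where x: "x \<in> carrier_vec n" "x \<noteq> 0\<^sub>v n" and px: "\<And>i. i < k + c \<Longrightarrow> p i \<bullet> x = 0"
    and xB: "x \<bullet> (B *\<^sub>v x) \<le> ordered_spectrum B ! (k + c) * (x \<bullet> x)"
    using ex_quadratic_form_le_ordered_spectrum[OF B k] by blast
  have "?a ! k * (x \<bullet> x) \<le> x \<bullet> (A *\<^sub>v x)"
    unfolding qx[OF x(1)] sum_distrib_left
  proof (intro sum_mono)
    fix i assume "i \<in> {..<n}"
    then have i: "i < n" by simp
    show "?a ! k * (q i \<bullet> x)\<^sup>2 \<le> ?a ! i * (q i \<bullet> x)\<^sup>2"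
    proof (cases "k \<le> i")
      case True
      then show ?thesis using sorted_nth_mono[OF sorted_ordered_spectrum, of k i A] i len
        by (intro mult_right_mono) auto
    next
      case False
      then show ?thesis using px[of i] by (simp add: p_def)
    qed
  qed
  also have "r i \<bullet> x = 0" if "i < c" for i using px[of "k + i"] that by (simp add: p_def)
  then have "x \<bullet> (A *\<^sub>v x) \<le> x \<bullet> (B *\<^sub>v x)" by (rule le[OF x(1)])
  also note xB
  finally show ?thesis using real_vec_scalar_prod_pos[OF x] by simp
qed

section \<open>The quadratic form of the net-Laplacian\<close>

lemma net_laplacian_carrier: "net_laplacian \<Gamma> us \<in> carrier_mat (length us) (length us)"
  by (rule carrier_matI) (simp_all add: net_laplacian_def sdeg_matrix_def adj_matrix_def)

lemma transpose_net_laplacian: "(net_laplacian \<Gamma> us)\<^sup>T = net_laplacian \<Gamma> us"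
  by (intro eq_matI) (auto simp: net_laplacian_def sdeg_matrix_def adj_matrix_def insert_commute)

lemma finite_edges: "signed_graph \<Gamma> \<Longrightarrow> finite (edges \<Gamma>)"
  unfolding signed_graph_def by (meson PowI finite_Pow_iff finite_subset subsetI)

lemma sdeg_eq_sum_sign:
  assumes "signed_graph \<Gamma>"
  shows "sdeg \<Gamma> u = (\<Sum>e | e \<in> edges \<Gamma> \<and> u \<in> e. sign \<Gamma> e)"
proof -
  let ?F = "{e \<in> edges \<Gamma>. u \<in> e}"
  have F: "finite ?F" using finite_edges[OF assms] by simp
  have "int (card {e \<in> edges \<Gamma>. u \<in> e \<and> sign \<Gamma> e = c}) = (\<Sum>e\<in>?F. if sign \<Gamma> e = c then 1 else 0)" for c
    using F by (simp add: sum.If_cases Int_def conj_assoc)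
  then have "sdeg \<Gamma> u = (\<Sum>e\<in>?F. (if sign \<Gamma> e = 1 then 1 else 0) - (if sign \<Gamma> e = -1 then 1 else 0))"
    by (simp add: sdeg_def pos_degree_def neg_degree_def sum_subtractf)
  also have "\<dots> = (\<Sum>e\<in>?F. sign \<Gamma> e)"
    using assms by (intro sum.cong refl) (auto simp: signed_graph_def)
  finally show ?thesis .
qed

text \<open>An edge at \<open>us ! l\<close> is determined by its other end, so the nonzero entries
  of the row correspond to the edges at this vertex. It follows that the rows of the net-Laplacian
  sum to 0, which is why its form depends only on differences of coordinates.\<close>

lemma sdeg_eq_row_sum:
  assumes \<Gamma>: "signed_graph \<Gamma>" and us: "distinct us" "set us = verts \<Gamma>" and l: "l < length us"
  shows "of_int (sdeg \<Gamma> (us ! l)) = (\<Sum>k<length us. adj_matrix \<Gamma> us $$ (l, k))"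
proof -
  let ?K = "{k. k < length us \<and> {us ! l, us ! k} \<in> edges \<Gamma>}"
  let ?F = "{e. e \<in> edges \<Gamma> \<and> us ! l \<in> e}"
  have bij: "bij_betw (\<lambda>k. {us ! l, us ! k}) ?K ?F"
    unfolding bij_betw_def
  proof (intro conjI inj_onI equalityI subsetI)
    fix j k assume "j \<in> ?K" "k \<in> ?K" "{us ! l, us ! j} = {us ! l, us ! k}"
    then show "j = k" using us(1) by (auto simp: doubleton_eq_iff nth_eq_iff_index_eq)
  next
    fix e assume e: "e \<in> ?F"
    then have "card e = 2" "e \<subseteq> set us" using \<Gamma> us by (auto simp: signed_graph_def)
    then obtain y where "e = {us ! l, y}" "y \<in> set us" using e by (auto simp: card_2_iff)
    then show "e \<in> (\<lambda>k. {us ! l, us ! k}) ` ?K" using e by (auto simp: in_set_conv_nth)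
  qed auto
  have "(\<Sum>k<length us. adj_matrix \<Gamma> us $$ (l, k)) = (\<Sum>k\<in>?K. of_int (sign \<Gamma> {us ! l, us ! k}))"
    using l by (intro sum.mono_neutral_cong_right) (auto simp: adj_matrix_def)
  also have "\<dots> = (\<Sum>e\<in>?F. of_int (sign \<Gamma> e))" by (rule sum.reindex_bij_betw[OF bij])
  finally show ?thesis by (simp add: sdeg_eq_sum_sign[OF \<Gamma>])
qed

text \<open>The factor 2 arises because the double sum meets every edge once in each
  direction.\<close>

lemma net_laplacian_quadratic_form:
  assumes \<Gamma>: "signed_graph \<Gamma>" and us: "distinct us" "set us = verts \<Gamma>"
    and x: "x \<in> carrier_vec (length us)"
  shows "2 * (x \<bullet> (net_laplacian \<Gamma> us *\<^sub>v x)) =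
    (\<Sum>l<length us. \<Sum>k<length us. adj_matrix \<Gamma> us $$ (l, k) * (x $ l - x $ k)\<^sup>2)"
proof -
  let ?n = "length us" and ?s = "\<lambda>l k. adj_matrix \<Gamma> us $$ (l, k)"
  let ?T = "\<Sum>l<?n. \<Sum>k<?n. ?s l k * (x $ l * x $ l - x $ l * x $ k)"
  have row: "(net_laplacian \<Gamma> us *\<^sub>v x) $ l = (\<Sum>k<?n. ?s l k * (x $ l - x $ k))" if l: "l < ?n" for l
  proof -
    have "(net_laplacian \<Gamma> us *\<^sub>v x) $ l = (\<Sum>k<?n. net_laplacian \<Gamma> us $$ (l, k) * x $ k)"
      using l x net_laplacian_carrier[of \<Gamma> us] by (simp add: scalar_prod_def atLeast0LessThan)
    also have "\<dots> = (\<Sum>k<?n. (if k = l then of_int (sdeg \<Gamma> (us ! l)) * x $ l else 0) - ?s l k * x $ k)"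
      using l by (intro sum.cong refl)
        (auto simp: net_laplacian_def sdeg_matrix_def adj_matrix_def algebra_simps)
    also have "\<dots> = of_int (sdeg \<Gamma> (us ! l)) * x $ l - (\<Sum>k<?n. ?s l k * x $ k)"
      using l by (simp add: sum_subtractf)
    also have "\<dots> = (\<Sum>k<?n. ?s l k * (x $ l - x $ k))"
      by (simp add: sdeg_eq_row_sum[OF \<Gamma> us l] sum_distrib_right sum_subtractf right_diff_distrib)
    finally show ?thesis .
  qed
  have "x \<bullet> (net_laplacian \<Gamma> us *\<^sub>v x) = (\<Sum>l<?n. x $ l * (net_laplacian \<Gamma> us *\<^sub>v x) $ l)"
    using net_laplacian_carrier[of \<Gamma> us] by (simp add: scalar_prod_def atLeast0LessThan)
  also have "\<dots> = ?T"
    by (intro sum.cong refl) (simp add: row sum_distrib_left algebra_simps)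
  finally have T: "x \<bullet> (net_laplacian \<Gamma> us *\<^sub>v x) = ?T" .
  \<comment> \<open>Exchanging the two indices, which the symmetry of the adjacency matrix permits,
    gives a second expression for \<open>?T\<close>; the two expressions add up to the squares of
    the differences.\<close>
  have "?T = (\<Sum>k<?n. \<Sum>l<?n. ?s l k * (x $ l * x $ l - x $ l * x $ k))" by (rule sum.swap)
  also have "\<dots> = (\<Sum>l<?n. \<Sum>k<?n. ?s l k * (x $ k * x $ k - x $ l * x $ k))"
    by (intro sum.cong refl) (auto simp: adj_matrix_def insert_commute mult.commute)
  finally have "2 * ?T = ?T + \<dots>" by simp
  also have "\<dots> = (\<Sum>l<?n. \<Sum>k<?n. ?s l k * (x $ l - x $ k)\<^sup>2)"
    unfolding sum.distrib[symmetric]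
    by (intro sum.cong refl) (simp add: power2_eq_square algebra_simps)
  finally show ?thesis using T by simp
qed

text \<open>Every adjacency entry is at least -1, and putting -1 everywhere gives the negative of
  the form of the complete graph.\<close>

lemma net_laplacian_quadratic_form_ge:
  assumes \<Gamma>: "signed_graph \<Gamma>" and us: "distinct us" "set us = verts \<Gamma>"
    and x: "x \<in> carrier_vec (length us)"
  shows "- real (length us) * (x \<bullet> x) \<le> x \<bullet> (net_laplacian \<Gamma> us *\<^sub>v x)"
proof -
  let ?n = "length us"
  have "- (\<Sum>l<?n. \<Sum>k<?n. (x $ l - x $ k)\<^sup>2) = (\<Sum>l<?n. \<Sum>k<?n. (- 1) * (x $ l - x $ k)\<^sup>2)"
    by (simp add: sum_negf)
  also have "\<dots> \<le> (\<Sum>l<?n. \<Sum>k<?n. adj_matrix \<Gamma> us $$ (l, k) * (x $ l - x $ k)\<^sup>2)"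
    using \<Gamma> by (intro sum_mono mult_right_mono) (auto simp: adj_matrix_def signed_graph_def)
  also have "\<dots> = 2 * (x \<bullet> (net_laplacian \<Gamma> us *\<^sub>v x))"
    using net_laplacian_quadratic_form[OF assms] by simp
  finally have "- (\<Sum>l<?n. \<Sum>k<?n. (x $ l - x $ k)\<^sup>2) \<le> 2 * (x \<bullet> (net_laplacian \<Gamma> us *\<^sub>v x))" .
  \<comment> \<open>This is twice the Laplacian form of the complete graph; discarding the square of
    the coordinate sum leaves the upper bound \<open>2 * real ?n * (x \<bullet> x)\<close>.\<close>
  moreover have "(\<Sum>l<?n. \<Sum>k<?n. (x $ l - x $ k)\<^sup>2) = 2 * real ?n * (x \<bullet> x) - 2 * (\<Sum>l<?n. x $ l)\<^sup>2"
  proof -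
    have "(\<Sum>l<?n. \<Sum>k<?n. (x $ l - x $ k)\<^sup>2)
        = (\<Sum>l<?n. \<Sum>k<?n. x $ l * x $ l + x $ k * x $ k - 2 * (x $ l * x $ k))"
      by (intro sum.cong refl) (simp add: power2_eq_square algebra_simps)
    also have "\<dots> = 2 * real ?n * (\<Sum>l<?n. x $ l * x $ l) - 2 * (\<Sum>l<?n. \<Sum>k<?n. x $ l * x $ k)"
      by (simp add: sum.distrib sum_subtractf sum_distrib_left[symmetric])
    also have "(\<Sum>l<?n. \<Sum>k<?n. x $ l * x $ k) = (\<Sum>l<?n. x $ l)\<^sup>2"
      by (simp add: power2_eq_square sum_product)
    also have "(\<Sum>l<?n. x $ l * x $ l) = x \<bullet> x" using x by (simp add: scalar_prod_def atLeast0LessThan)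
    finally show ?thesis .
  qed
  moreover have "0 \<le> (\<Sum>l<?n. x $ l)\<^sup>2" by simp
  ultimately show ?thesis by linarith
qed

section \<open>Removal of a positive edge and interlacing\<close>

lemma signed_graph_remove_edge: "signed_graph \<Gamma> \<Longrightarrow> signed_graph (remove_edge \<Gamma> e)"
  by (simp add: signed_graph_def remove_edge_def)

lemma verts_remove_edge [simp]: "verts (remove_edge \<Gamma> e) = verts \<Gamma>"
  by (simp add: remove_edge_def)

text \<open>Only the entries for the two orderings of the ends of \<open>e\<close> change, each by
  1. In the doubled form each contributes the same square, so the form itself loses one square, that
  of the difference of the two coordinates.\<close>

lemma net_laplacian_remove_positive_edge:
  assumes \<Gamma>: "signed_graph \<Gamma>" and us: "distinct us" "set us = verts \<Gamma>"
    and e: "e \<in> edges \<Gamma>" "sign \<Gamma> e = 1"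
  obtains w where "w \<in> carrier_vec (length us)"
    and "\<And>x. x \<in> carrier_vec (length us) \<Longrightarrow> x \<bullet> (net_laplacian \<Gamma> us *\<^sub>v x) =
      x \<bullet> (net_laplacian (remove_edge \<Gamma> e) us *\<^sub>v x) + (w \<bullet> x)\<^sup>2"
proof -
  let ?n = "length us" and ?\<Gamma>' = "remove_edge \<Gamma> e"
  have "card e = 2" "e \<subseteq> set us" using \<Gamma> e us by (auto simp: signed_graph_def)
  then obtain u u' where uu': "e = {u, u'}" "u \<noteq> u'" "u \<in> set us" "u' \<in> set us"
    by (auto simp: card_2_iff)
  then obtain i j where "us ! i = u" "us ! j = u'" "i < ?n" "j < ?n"
    by (metis in_set_conv_nth)
  then have e_eq: "e = {us ! i, us ! j}" and ij: "i < ?n" "j < ?n" "i \<noteq> j" using uu' by auto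
  have eq_e: "{us ! l, us ! k} = e \<longleftrightarrow> l = i \<and> k = j \<or> l = j \<and> k = i" if "l < ?n" "k < ?n" for l k
    using that ij us(1) by (auto simp: e_eq doubleton_eq_iff nth_eq_iff_index_eq)
  \<comment> \<open>The nested conditionals let the double sum below collapse one index at a
    time.\<close>
  have adj: "adj_matrix \<Gamma> us $$ (l, k) = adj_matrix ?\<Gamma>' us $$ (l, k)
      + (if k = j then if l = i then 1 else 0 else 0)
      + (if k = i then if l = j then 1 else 0 else 0)" if "l < ?n" "k < ?n" for l k
    using that e eq_e[OF that] ij(3) by (auto simp: adj_matrix_def remove_edge_def)
  define w :: "real vec" where "w = unit_vec ?n i - unit_vec ?n j"
  have w: "w \<in> carrier_vec ?n" by (simp add: w_def)
  have wx: "w \<bullet> x = x $ i - x $ j" if "x \<in> carrier_vec ?n" for x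
    using that ij by (simp add: w_def minus_scalar_prod_distrib[of _ ?n] scalar_prod_left_unit)
  have "x \<bullet> (net_laplacian \<Gamma> us *\<^sub>v x) = x \<bullet> (net_laplacian ?\<Gamma>' us *\<^sub>v x) + (w \<bullet> x)\<^sup>2"
    if x: "x \<in> carrier_vec ?n" for x
  proof -
    have "2 * (x \<bullet> (net_laplacian \<Gamma> us *\<^sub>v x))
        = (\<Sum>l<?n. \<Sum>k<?n. adj_matrix ?\<Gamma>' us $$ (l, k) * (x $ l - x $ k)\<^sup>2
          + (if k = j then if l = i then (x $ i - x $ j)\<^sup>2 else 0 else 0)
          + (if k = i then if l = j then (x $ j - x $ i)\<^sup>2 else 0 else 0))"
      unfolding net_laplacian_quadratic_form[OF \<Gamma> us x]
      by (intro sum.cong refl) (auto simp: adj algebra_simps)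
    also have "\<dots> = 2 * (x \<bullet> (net_laplacian ?\<Gamma>' us *\<^sub>v x)) + (x $ i - x $ j)\<^sup>2 + (x $ j - x $ i)\<^sup>2"
      using ij net_laplacian_quadratic_form[OF signed_graph_remove_edge[OF \<Gamma>] us(1) _ x, of e] us(2)
      by (simp add: sum.distrib)
    finally show ?thesis using wx[OF x] by (simp add: power2_commute)
  qed
  then show thesis using w that by blast
qed

theorem theorem3p3:
  fixes \<Gamma> \<Gamma>' :: "'a signed_graph" and e :: "'a set" and us :: "'a list"
    and m :: nat and \<alpha> \<beta> :: "nat \<Rightarrow> real"
  assumes "signed_graph \<Gamma>"
    and "card (verts \<Gamma>) = m"
    and "distinct us" and "set us = verts \<Gamma>"
    and "e \<in> edges \<Gamma>" and "sign \<Gamma> e = 1"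
    and "\<Gamma>' = remove_edge \<Gamma> e"
    and "\<And>p. p \<in> {1..m} \<Longrightarrow> \<alpha> p = ordered_spectrum (net_laplacian \<Gamma> us) ! (p - 1)"
    and "\<And>p. p \<in> {1..m} \<Longrightarrow> \<beta> p = ordered_spectrum (net_laplacian \<Gamma>' us) ! (p - 1)"
    and "\<alpha> 0 = - real m"
  shows "\<forall>p\<in>{1..m}. \<alpha> (p - 1) \<le> \<beta> p \<and> \<beta> p \<le> \<alpha> p"
proof
  fix p assume p: "p \<in> {1..m}"
  let ?N = "net_laplacian \<Gamma> us" and ?N' = "net_laplacian \<Gamma>' us"
  have m: "length us = m" using assms(2-4) by (metis distinct_card)
  have N: "?N \<in> carrier_mat m m" "?N\<^sup>T = ?N" and N': "?N' \<in> carrier_mat m m" "?N'\<^sup>T = ?N'"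
    using net_laplacian_carrier transpose_net_laplacian m by auto
  obtain w where w: "w \<in> carrier_vec m"
    and Nx: "\<And>x. x \<in> carrier_vec m \<Longrightarrow> x \<bullet> (?N *\<^sub>v x) = x \<bullet> (?N' *\<^sub>v x) + (w \<bullet> x)\<^sup>2"
    using net_laplacian_remove_positive_edge[OF assms(1,3-6)] unfolding m assms(7) by blast
  \<comment> \<open>The added square is nonnegative, so the forms compare on the whole space and
    \<open>c = 0\<close> gives no shift. List positions start at 0, hence
    \<open>p - 1\<close>.\<close>
  have "ordered_spectrum ?N' ! (p - 1) \<le> ordered_spectrum ?N ! (p - 1 + 0)"
    by (rule ordered_spectrum_le_shift[OF N' N, where r = "\<lambda>_. w"]) (use p w Nx in auto)
  then have "\<beta> p \<le> \<alpha> p" using p assms(8,9) by simp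
  moreover have "\<alpha> (p - 1) \<le> \<beta> p"
  proof (cases "p = 1")
    case True
    \<comment> \<open>Here \<open>\<alpha> 0\<close> is the conventional value, and the lower bound
      is applied to \<Gamma>', which is again a signed graph on the same \<open>m\<close>
      vertices.\<close>
    have "- real m \<le> ordered_spectrum ?N' ! 0"
      using net_laplacian_quadratic_form_ge[OF signed_graph_remove_edge[OF assms(1)] assms(3)] assms(4) p
      by (intro ordered_spectrum_ge[OF N']) (auto simp: m assms(7))
    then show ?thesis using True p assms(9,10) by simp
  next
    case False
    \<comment> \<open>The two forms agree on vectors orthogonal to \<open>w\<close>. This one
      condition costs one index, from position \<open>p - 2\<close> of
      \<open>\<alpha> (p - 1)\<close> to position \<open>p - 1\<close> of
      \<open>\<beta> p\<close>.\<close>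
    have "ordered_spectrum ?N ! (p - 2) \<le> ordered_spectrum ?N' ! (p - 2 + 1)"
      by (rule ordered_spectrum_le_shift[OF N N', where r = "\<lambda>_. w"]) (use p False w Nx in auto)
    moreover have "p - 2 + 1 = p - 1" "p - 1 - 1 = p - 2" "p - 1 \<in> {1..m}" using p False by auto
    ultimately show ?thesis using p assms(8)[of "p - 1"] assms(9)[of p] by simp
  qed
  ultimately show "\<alpha> (p - 1) \<le> \<beta> p \<and> \<beta> p \<le> \<alpha> p" by simp
qed

end
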